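(* The oracle information in $\mathcal{I}_{\mathcal{Z}}$ applies to $p$ as well, namely $p(z_i)=f_i$ and $\nabla p(z_i)=g_i$ for all $i=1,\dots,m$.
   Context: $\mathbb{E}$ is an $n$-dimensional real vector space, $\mathbb{E}^*$ its dual, $\langle s,x\rangle$ the value of $s\in\mathbb{E}^*$ at $x\in\mathbb{E}$. $B:\mathbb{E}\to\mathbb{E}^*$ is a symmetric positive definite linear operator, $\|x\|=\sqrt{\langle Bx,x\rangle}$ on $\mathbb{E}$ and $\|g\|_*=\sqrt{\langle g,B^{-1}g\rangle}$ on $\mathbb{E}^*$. $f:\mathbb{E}\to\mathbb{R}$ is convex and differentiable, with gradient Lipschitz continuous with constant $L_f>0$ (i.e. $\|\nabla f(x)-\nabla f(y)\|_*\le L_f\|x-y\|$). Points $z_1,\dots,z_m\in\mathbb{E}$ ($m\ge1$) are given, with $f_i=f(z_i)$, $g_i=\nabla f(z_i)$, and $\mathcal{I}_{\mathcal{Z}}=\{(z_i,f_i,g_i)\mid i=1,\dots,m\}$. Define $\phi(y,g)=\max_{i=1,\dots,m}\left\{f_i+\langle g_i,y-z_i\rangle+\frac{1}{2L_f}\|g-g_i\|_*^2\right\}$ and $p(y)=\min_{g\in\mathbb{E}^*}\phi(y,g)$ for $y\in\mathbb{E}$, $g\in\mathbb{E}^*$. *)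

theory Defs
  imports "HOL-Analysis.Analysis"
begin

text \<open>
  The space is a type of class \<open>euclidean_space\<close>, which supplies finite dimension and the
  topology; its built-in inner product is never used. The dual is the type \<open>'a dual\<close> of
  continuous linear functionals, i.e. of all linear functionals, since the dimension is finite.
  The pairing of \<open>s\<close> and \<open>x\<close> is the application \<open>blinfun_apply s x\<close>.
\<close>

type_synonym 'a dual = "'a \<Rightarrow>\<^sub>L real"

definition sym_pos_def :: "('a::euclidean_space \<Rightarrow> 'a dual) \<Rightarrow> bool" where
  "sym_pos_def B \<longleftrightarrow>
     linear B \<and>
     (\<forall>x y. blinfun_apply (B x) y = blinfun_apply (B y) x) \<and>
     (\<forall>x. x \<noteq> 0 \<longrightarrow> blinfun_apply (B x) x > 0)"

definition primal_norm :: "('a::euclidean_space \<Rightarrow> 'a dual) \<Rightarrow> 'a \<Rightarrow> real" where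
  "primal_norm B x = sqrt (blinfun_apply (B x) x)"

definition dual_norm :: "('a::euclidean_space \<Rightarrow> 'a dual) \<Rightarrow> 'a dual \<Rightarrow> real" where
  "dual_norm B g = sqrt (blinfun_apply g (inv B g))"

definition phi ::
  "('a::euclidean_space \<Rightarrow> 'a dual) \<Rightarrow> real \<Rightarrow> nat \<Rightarrow> (nat \<Rightarrow> 'a) \<Rightarrow> (nat \<Rightarrow> real) \<Rightarrow> (nat \<Rightarrow> 'a dual)
     \<Rightarrow> 'a \<Rightarrow> 'a dual \<Rightarrow> real" where
  "phi B L m z fv gv y g =
     (MAX i\<in>{1..m}. fv i + blinfun_apply (gv i) (y - z i) + 1 / (2 * L) * (dual_norm B (g - gv i))\<^sup>2)"

text \<open>
  The minimum over the dual is the least element of the set of attained values; this is stronger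
  than an infimum, as \<open>LEAST\<close> is unspecified when the infimum is not attained.
\<close>

definition interp ::
  "('a::euclidean_space \<Rightarrow> 'a dual) \<Rightarrow> real \<Rightarrow> nat \<Rightarrow> (nat \<Rightarrow> 'a) \<Rightarrow> (nat \<Rightarrow> real) \<Rightarrow> (nat \<Rightarrow> 'a dual)
     \<Rightarrow> 'a \<Rightarrow> real" where
  "interp B L m z fv gv y = (LEAST v. v \<in> range (phi B L m z fv gv y))"

end

theory Submission
  imports Defs
begin

text \<open>
  Co-coercivity of the gradient gives $\phi(y, \nabla f(y)) \le f(y)$, hence $p \le f$. Dropping the
  squared norm gives $p(y) \ge f_i + \langle g_i, y - z_i\rangle$. So near $z_i$ the function $p$
  is squeezed between $f$ and its tangent at $z_i$, which agree at $z_i$ to first order.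
\<close>

section \<open>Calculus: squeezed derivatives, tangents of convex functions, finite maxima\<close>

text \<open>The first-order remainder of \<open>p\<close> at \<open>x\<close> is nonnegative by
  \<open>lower\<close> and at most that of \<open>f\<close> by \<open>upper\<close>, so its quotient
  by the norm is squeezed to 0.\<close>

lemma has_derivative_between_tangent:
  fixes f p :: "'a::real_normed_vector \<Rightarrow> real"
  assumes f: "(f has_derivative D) (at x)"
    and lower: "\<And>y. f x + D (y - x) \<le> p y"
    and upper: "\<And>y. p y \<le> f y"
  shows "(p has_derivative D) (at x)"
proof -
  have D: "bounded_linear D"
    and lim: "((\<lambda>y. ((f y - f x) - D (y - x)) /\<^sub>R norm (y - x)) \<longlongrightarrow> 0) (at x)"
    using f by (auto simp: has_derivative_at_within)
  have "D 0 = 0"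
    using D by (simp add: linear_simps)
  then have eq: "p x = f x"
    using lower[of x] upper[of x] by simp
  have "((\<lambda>y. ((p y - p x) - D (y - x)) /\<^sub>R norm (y - x)) \<longlongrightarrow> 0) (at x)"
  proof (rule tendsto_sandwich[OF _ _ tendsto_const lim])
    show "\<forall>\<^sub>F y in at x. 0 \<le> ((p y - p x) - D (y - x)) /\<^sub>R norm (y - x)"
      using lower by (intro always_eventually allI) (simp add: eq le_diff_eq add.commute)
    show "\<forall>\<^sub>F y in at x. ((p y - p x) - D (y - x)) /\<^sub>R norm (y - x)
            \<le> ((f y - f x) - D (y - x)) /\<^sub>R norm (y - x)"
      using upper by (intro always_eventually allI) (simp add: eq mult_left_mono)
  qed
  then show ?thesis
    using D by (simp add: has_derivative_at_within)
qed

lemma has_derivative_along_line: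
  fixes f :: "'a::real_normed_vector \<Rightarrow> real"
  assumes "(f has_derivative D) (at (x + t *\<^sub>R d))"
  shows "((\<lambda>t. f (x + t *\<^sub>R d)) has_real_derivative D d) (at t)"
proof -
  have line: "((\<lambda>t. x + t *\<^sub>R d) has_derivative (\<lambda>h. h *\<^sub>R d)) (at t)"
    by (auto intro!: derivative_eq_intros)
  have "((\<lambda>t. f (x + t *\<^sub>R d)) has_derivative (\<lambda>h. D (h *\<^sub>R d))) (at t)"
    using has_derivative_compose[OF line assms] .
  moreover have "D (h *\<^sub>R d) = D d * h" for h
    using has_derivative_bounded_linear[OF assms] by (simp add: linear_simps)
  ultimately show ?thesis
    by (simp add: has_field_derivative_def)
qed

text \<open>Restriction to the line through \<open>x\<close> and \<open>y\<close> reduces this to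
  the tangent inequality in one real variable, applied between the parameters 0 and 1.\<close>

lemma convex_on_above_tangent:
  fixes f :: "'a::real_normed_vector \<Rightarrow> real"
  assumes convex: "convex_on UNIV f" and f: "(f has_derivative D) (at x)"
  shows "f x + D (y - x) \<le> f y"
proof -
  let ?k = "\<lambda>t. f (x + t *\<^sub>R (y - x))"
  have "convex_on UNIV ?k"
  proof (rule convex_onI)
    fix t a b :: real assume t: "0 < t" "t < 1"
    have "x + ((1 - t) *\<^sub>R a + t *\<^sub>R b) *\<^sub>R (y - x)
        = (1 - t) *\<^sub>R (x + a *\<^sub>R (y - x)) + t *\<^sub>R (x + b *\<^sub>R (y - x))"
      by (simp add: algebra_simps)
    then show "?k ((1 - t) *\<^sub>R a + t *\<^sub>R b) \<le> (1 - t) * ?k a + t * ?k b"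
      using convex_onD[OF convex, of t "x + a *\<^sub>R (y - x)" "x + b *\<^sub>R (y - x)"] t by simp
  qed auto
  moreover have "(?k has_real_derivative D (y - x)) (at 0)"
    using f by (intro has_derivative_along_line) simp
  ultimately have "?k 1 - ?k 0 \<ge> D (y - x) * (1 - 0)"
    by (intro convex_on_imp_above_tangent[where A = UNIV]) auto
  then show ?thesis by simp
qed

lemma continuous_on_Max_image:
  fixes F :: "'i \<Rightarrow> 'a::topological_space \<Rightarrow> 'b::linorder_topology"
  assumes "finite I" "I \<noteq> {}" "\<And>i. i \<in> I \<Longrightarrow> continuous_on S (F i)"
  shows "continuous_on S (\<lambda>x. MAX i\<in>I. F i x)"
  using assms
proof (induction I rule: finite_ne_induct)
  case (insert i I)
  then have "(MAX j\<in>insert i I. F j x) = max (F i x) (MAX j\<in>I. F j x)" for x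
    by simp
  with insert show ?case
    by (simp add: continuous_on_max)
qed simp

section \<open>The operator \<open>B\<close> and the norms it induces\<close>

context
  fixes B :: "'a::euclidean_space \<Rightarrow> 'a dual"
  assumes B: "sym_pos_def B"
begin

lemma spd_linear: "linear B"
  using B by (simp add: sym_pos_def_def)

lemma spd_commute: "blinfun_apply (B x) y = blinfun_apply (B y) x"
  using B by (simp add: sym_pos_def_def)

lemma spd_pos: "x \<noteq> 0 \<Longrightarrow> 0 < blinfun_apply (B x) x"
  using B by (simp add: sym_pos_def_def)

lemma spd_nonneg: "0 \<le> blinfun_apply (B x) x"
  using spd_pos[of x] by (cases "x = 0") (auto simp: linear_0[OF spd_linear])

lemmas spd_simps = linear_add[OF spd_linear] linear_diff[OF spd_linear]
  linear_scale[OF spd_linear] blinfun.bilinear_simps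

lemma spd_inj: "inj B"
  unfolding linear_injective_0[OF spd_linear] using spd_pos by fastforce

text \<open>An injective linear map between spaces of equal finite dimension is onto. A functional
  is replaced by the vector of its values on \<open>Basis\<close>, so that \<open>?T\<close> is
  \<open>B\<close> read as an endomorphism of the primal space.\<close>

lemma spd_surj: "surj B"
proof -
  let ?T = "\<lambda>u. \<Sum>b\<in>Basis. blinfun_apply (B u) b *\<^sub>R b"
  have T_Basis: "?T u \<bullet> b = blinfun_apply (B u) b" if "b \<in> Basis" for u b
    using that by simp
  have linear: "linear ?T"
    by (rule linearI) (simp_all add: spd_simps scaleR_add_left sum.distrib scaleR_sum_right)
  moreover have "inj ?T"
  proof (rule injI)
    fix u v assume "?T u = ?T v"
    then have "B u = B v"
      by (intro blinfun_euclidean_eqI) (metis T_Basis)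
    then show "u = v"
      using spd_inj by (simp add: inj_eq)
  qed
  ultimately have "surj ?T"
    by (simp add: linear_injective_imp_surjective)
  have "\<exists>u. s = B u" for s
  proof -
    obtain u where u: "(\<Sum>b\<in>Basis. blinfun_apply s b *\<^sub>R b) = ?T u"
      using surjD[OF \<open>surj ?T\<close>] by blast
    have "s = B u"
    proof (rule blinfun_euclidean_eqI)
      fix b :: 'a assume b: "b \<in> Basis"
      have "(\<Sum>b\<in>Basis. blinfun_apply s b *\<^sub>R b) \<bullet> b = blinfun_apply s b"
        using b by simp
      then show "blinfun_apply s b = blinfun_apply (B u) b"
        using T_Basis[OF b, of u] u by simp
    qed
    then show ?thesis ..
  qed
  then show ?thesis by (auto simp: surj_def)
qed

text \<open>Since \<open>B\<close> is onto, every functional has the form \<open>B u\<close>; this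
  substitution clears \<open>inv B\<close> from squared dual norms.\<close>

lemma dual_norm_spd: "(dual_norm B (B u))\<^sup>2 = blinfun_apply (B u) u"
  by (simp add: dual_norm_def inv_f_f[OF spd_inj] spd_nonneg)

lemma primal_norm_power2: "(primal_norm B x)\<^sup>2 = blinfun_apply (B x) x"
  by (simp add: primal_norm_def spd_nonneg)

lemma spd_continuous: "continuous_on UNIV (\<lambda>x. blinfun_apply (B x) x)"
  using linear_continuous_on[of B UNIV] spd_linear
  by (intro continuous_intros) (simp add: linear_conv_bounded_linear)

text \<open>The constant is the minimum of the quadratic form on the compact unit sphere;
  homogeneity of degree two carries the bound to all vectors.\<close>

lemma spd_coercive: "\<exists>c>0. \<forall>x. c * (norm x)\<^sup>2 \<le> blinfun_apply (B x) x"
proof -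
  have "sphere (0::'a) 1 \<noteq> {}" by simp
  with continuous_attains_inf[OF compact_sphere this
      continuous_on_subset[OF spd_continuous subset_UNIV]]
  obtain x0 where x0: "x0 \<in> sphere 0 1"
    and min: "\<And>x. x \<in> sphere 0 1 \<Longrightarrow> blinfun_apply (B x0) x0 \<le> blinfun_apply (B x) x"
    by blast
  have "blinfun_apply (B x0) x0 * (norm x)\<^sup>2 \<le> blinfun_apply (B x) x" for x
  proof (cases "x = 0")
    case True
    then show ?thesis by (simp add: linear_0[OF spd_linear])
  next
    case False
    then have "blinfun_apply (B x0) x0 \<le> blinfun_apply (B (x /\<^sub>R norm x)) (x /\<^sub>R norm x)"
      by (intro min) simp
    also have "\<dots> = blinfun_apply (B x) x / (norm x)\<^sup>2"
      by (simp add: spd_simps power2_eq_square field_simps)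
    finally show ?thesis
      using False by (simp add: field_simps)
  qed
  moreover have "0 < blinfun_apply (B x0) x0"
    using x0 by (intro spd_pos) auto
  ultimately show ?thesis by blast
qed

text \<open>A Cauchy-Schwarz bound: with \<open>s = B u\<close>, expand the form at
  \<open>u - c *\<^sub>R d\<close>, which is nonnegative, and bound its value at \<open>u\<close> by
  the squared hypothesis.\<close>

lemma pairing_le_of_dual_norm_le:
  assumes "dual_norm B s \<le> c * primal_norm B d" "0 < c"
  shows "blinfun_apply s d \<le> c * blinfun_apply (B d) d"
proof -
  obtain u where s: "s = B u"
    using surjD[OF spd_surj] by blast
  have "0 \<le> dual_norm B (B u)"
    by (simp add: dual_norm_def inv_f_f[OF spd_inj] spd_nonneg)
  then have "(dual_norm B (B u))\<^sup>2 \<le> (c * primal_norm B d)\<^sup>2"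
    using assms s by (intro power_mono) auto
  then have le: "blinfun_apply (B u) u \<le> c\<^sup>2 * blinfun_apply (B d) d"
    by (simp add: dual_norm_spd power_mult_distrib primal_norm_power2)
  have "0 \<le> blinfun_apply (B (u - c *\<^sub>R d)) (u - c *\<^sub>R d)"
    by (rule spd_nonneg)
  also have "\<dots> = blinfun_apply (B u) u - 2 * c * blinfun_apply (B u) d
      + c\<^sup>2 * blinfun_apply (B d) d"
    using spd_commute[of u d] by (simp add: spd_simps algebra_simps power2_eq_square)
  finally have "2 * c * blinfun_apply (B u) d \<le> 2 * c * (c * blinfun_apply (B d) d)"
    using le by (simp add: power2_eq_square algebra_simps)
  then show ?thesis
    using \<open>0 < c\<close> s by simp
qed

section \<open>Inequalities for a Lipschitz gradient\<close>

context
  fixes f :: "'a \<Rightarrow> real" and gradf :: "'a \<Rightarrow> 'a dual" and L :: real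
  assumes grad: "\<And>x. (f has_derivative blinfun_apply (gradf x)) (at x)"
    and L: "0 < L"
    and Lipschitz: "\<And>x y. dual_norm B (gradf x - gradf y) \<le> L * primal_norm B (x - y)"
begin

lemma descent_inequality:
  "f (x + d) \<le> f x + blinfun_apply (gradf x) d + L / 2 * blinfun_apply (B d) d"
proof -
  define q where "q = blinfun_apply (B d) d"
  \<comment> \<open>Along the segment, \<open>?k\<close> is \<open>f\<close> minus the non-constant
    terms of the quadratic upper model, so the claim says \<open>?k 1 \<le> ?k 0\<close>. The
    Lipschitz condition makes its derivative nonpositive, which avoids integration.\<close>
  let ?k = "\<lambda>t. f (x + t *\<^sub>R d) - t * blinfun_apply (gradf x) d - L * t\<^sup>2 / 2 * q"
  have "?k 1 \<le> ?k 0"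
  \<comment> \<open>The open interval matters: the pairing bound is applied with the constant
    \<open>L * t\<close>, which must be positive.\<close>
  proof (rule DERIV_nonpos_imp_decreasing_open[where f = ?k and a = 0 and b = 1])
    have k: "(?k has_real_derivative
        blinfun_apply (gradf (x + t *\<^sub>R d)) d - blinfun_apply (gradf x) d - L * t * q) (at t)" for t
      by (auto intro!: derivative_eq_intros has_derivative_along_line[OF grad])
    show "continuous_on {0..1} ?k"
      by (intro continuous_at_imp_continuous_on ballI DERIV_isCont[OF k])
    fix t :: real assume t: "0 < t" "t < 1"
    have "primal_norm B (t *\<^sub>R d) = t * primal_norm B d"
      using t by (simp add: primal_norm_def spd_simps real_sqrt_mult)
    then have "dual_norm B (gradf (x + t *\<^sub>R d) - gradf x) \<le> L * t * primal_norm B d"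
      using Lipschitz[of "x + t *\<^sub>R d" x] by simp
    then have "blinfun_apply (gradf (x + t *\<^sub>R d) - gradf x) d \<le> L * t * q"
      unfolding q_def using t L by (intro pairing_le_of_dual_norm_le) auto
    then show "\<exists>y. (?k has_real_derivative y) (at t) \<and> y \<le> 0"
      using k[of t] by (intro exI conjI) (auto simp: blinfun.diff_left)
  qed simp
  then show ?thesis by (simp add: q_def)
qed

text \<open>At an auxiliary point \<open>w\<close>, \<open>f\<close> lies above its tangent at
  \<open>x\<close> and below its quadratic model at \<open>y\<close>. In the comparison the terms
  \<open>blinfun_apply (gradf x) u\<close> cancel and the squared dual norm remains.\<close>

lemma cocoercivity:
  assumes convex: "convex_on UNIV f"
  shows "f x + blinfun_apply (gradf x) (y - x) + 1 / (2 * L) * (dual_norm B (gradf y - gradf x))\<^sup>2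
    \<le> f y"
proof -
  obtain u where u: "gradf y - gradf x = B u"
    using surjD[OF spd_surj] by blast
  \<comment> \<open>This is the gradient step of length \<open>1 / L\<close> from \<open>y\<close>
    for \<open>f\<close> minus the linear functional \<open>gradf x\<close>, whose derivative at
    \<open>y\<close> is \<open>B u\<close>; it minimizes the corresponding quadratic upper
    model.\<close>
  define w where "w = y + (- (1 / L)) *\<^sub>R u"
  have "f x + blinfun_apply (gradf x) (w - x) \<le> f w"
    by (rule convex_on_above_tangent[OF convex grad])
  also have "f w \<le> f y + blinfun_apply (gradf y) ((- (1 / L)) *\<^sub>R u)
      + L / 2 * blinfun_apply (B ((- (1 / L)) *\<^sub>R u)) ((- (1 / L)) *\<^sub>R u)"
    unfolding w_def by (rule descent_inequality)
  also have "L / 2 * blinfun_apply (B ((- (1 / L)) *\<^sub>R u)) ((- (1 / L)) *\<^sub>R u)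
      = 1 / (2 * L) * blinfun_apply (B u) u"
    using L unfolding linear_scale[OF spd_linear] by (simp add: blinfun.bilinear_simps)
  also have "blinfun_apply (gradf y) ((- (1 / L)) *\<^sub>R u)
      = - (1 / L) * blinfun_apply (gradf x) u - 1 / L * blinfun_apply (B u) u"
    unfolding u[symmetric] by (simp add: blinfun.bilinear_simps diff_divide_distrib)
  also have "blinfun_apply (gradf x) (w - x)
      = blinfun_apply (gradf x) (y - x) - 1 / L * blinfun_apply (gradf x) u"
    by (simp add: w_def blinfun.bilinear_simps)
  finally show ?thesis
    unfolding u dual_norm_spd by (simp add: field_simps)
qed

end

section \<open>Attainment of the minimum that defines \<open>interp\<close>\<close>

lemma phi_ge:
  assumes "i \<in> {1..m}"
  shows "fv i + blinfun_apply (gv i) (y - z i) + 1 / (2 * L) * (dual_norm B (g - gv i))\<^sup>2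
    \<le> phi B L m z fv gv y g"
  unfolding phi_def using assms by (intro Max_ge) auto

text \<open>Pulled back along \<open>B\<close>, the function is continuous on the primal space and
  grows at least quadratically, so a sublevel set is compact and contains a minimizer.\<close>

lemma phi_attains_min:
  assumes L: "0 < L" and m: "1 \<le> m"
  shows "\<exists>g. \<forall>h. phi B L m z fv gv y g \<le> phi B L m z fv gv y h"
proof -
  let ?P = "\<lambda>x. phi B L m z fv gv y (B x)"
  define a where "a = (\<lambda>i. inv B (gv i))"
  have a: "gv i = B (a i)" for i
    by (simp add: a_def surj_f_inv_f[OF spd_surj])
  have P: "?P = (\<lambda>x. MAX i\<in>{1..m}. fv i + blinfun_apply (gv i) (y - z i)
      + 1 / (2 * L) * blinfun_apply (B (x - a i)) (x - a i))"
    unfolding phi_def a by (simp only: linear_diff[OF spd_linear, symmetric] dual_norm_spd)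
  have cont: "continuous_on UNIV ?P"
    unfolding P using m
    by (intro continuous_on_Max_image continuous_intros
        continuous_on_compose2[OF spd_continuous]) auto
  obtain c where c: "0 < c" "\<And>x. c * (norm x)\<^sup>2 \<le> blinfun_apply (B x) x"
    using spd_coercive by blast
  \<comment> \<open>The level \<open>?P 0\<close> makes \<open>S\<close> nonempty, as it contains
    0.\<close>
  define S where "S = {x. ?P x \<le> ?P 0}"
  have "closed S"
    unfolding S_def by (intro closed_Collect_le cont continuous_intros)
  moreover have "bounded S"
  proof -
    \<comment> \<open>The piece of index 1 alone confines \<open>S\<close>: bound it by
      \<open>?P 0\<close>, solve for the quadratic form, and divide by the coercivity constant to
      get the squared radius around \<open>a 1\<close>.\<close>
    let ?R = "2 * L * (?P 0 - fv 1 - blinfun_apply (gv 1) (y - z 1)) / c"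
    have "dist (a 1) x \<le> sqrt ?R" if "x \<in> S" for x
    proof -
      have "fv 1 + blinfun_apply (gv 1) (y - z 1)
          + 1 / (2 * L) * blinfun_apply (B (x - a 1)) (x - a 1) \<le> ?P x"
        using phi_ge[of 1 m fv gv y z L "B x"] m
        by (simp only: a linear_diff[OF spd_linear, symmetric] dual_norm_spd) simp
      also have "\<dots> \<le> ?P 0" using that by (simp add: S_def)
      finally have "blinfun_apply (B (x - a 1)) (x - a 1)
          \<le> 2 * L * (?P 0 - fv 1 - blinfun_apply (gv 1) (y - z 1))"
        using L by (simp add: field_simps)
      with c(2)[of "x - a 1"] have "(norm (x - a 1))\<^sup>2 \<le> ?R"
        using c(1) by (simp add: field_simps)
      then show ?thesis
        by (simp add: dist_norm norm_minus_commute real_le_rsqrt)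
    qed
    then show ?thesis by (auto simp: bounded_def)
  qed
  ultimately have "compact S" by (simp add: compact_eq_bounded_closed)
  moreover have "0 \<in> S" by (simp add: S_def)
  ultimately obtain x where x: "x \<in> S" "\<And>x'. x' \<in> S \<Longrightarrow> ?P x \<le> ?P x'"
    using continuous_attains_inf[of S ?P] continuous_on_subset[OF cont subset_UNIV] by blast
  \<comment> \<open>Outside \<open>S\<close> the value exceeds \<open>?P 0\<close>, which is already
    at least \<open>?P x\<close>.\<close>
  have "?P x \<le> ?P x'" for x'
    using x by (cases "x' \<in> S") (force simp: S_def)+
  then have "?P x \<le> phi B L m z fv gv y h" for h
    using surj_f_inv_f[OF spd_surj, of h] by metis
  then show ?thesis by blast
qed

text \<open>Attainment is what lets \<open>LEAST\<close> denote the minimum; both bounds on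
  \<open>interp\<close> in the theorem rest on these two facts.\<close>

lemma interp_is_min:
  assumes "0 < L" "1 \<le> m"
  obtains g where "interp B L m z fv gv y = phi B L m z fv gv y g"
    and "\<And>h. interp B L m z fv gv y \<le> phi B L m z fv gv y h"
proof -
  obtain g where g: "\<And>h. phi B L m z fv gv y g \<le> phi B L m z fv gv y h"
    using phi_attains_min[OF assms] by blast
  then have "interp B L m z fv gv y = phi B L m z fv gv y g"
    unfolding interp_def by (intro Least_equality) auto
  with g that show thesis by metis
qed

end

theorem proposition2p6:
  fixes B :: "'a::euclidean_space \<Rightarrow> 'a dual"
    and f :: "'a \<Rightarrow> real"
    and gradf :: "'a \<Rightarrow> 'a dual"
    and L :: real
    and m :: nat
    and z :: "nat \<Rightarrow> 'a"
    and fv :: "nat \<Rightarrow> real"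
    and gv :: "nat \<Rightarrow> 'a dual"
  assumes "sym_pos_def B"
    and "convex_on UNIV f"
    and "\<And>x. (f has_derivative blinfun_apply (gradf x)) (at x)"
    and "L > 0"
    and "\<And>x y. dual_norm B (gradf x - gradf y) \<le> L * primal_norm B (x - y)"
    and "m \<ge> 1"
    and "\<And>i. i \<in> {1..m} \<Longrightarrow> fv i = f (z i)"
    and "\<And>i. i \<in> {1..m} \<Longrightarrow> gv i = gradf (z i)"
  shows "\<forall>i\<in>{1..m}.
           interp B L m z fv gv (z i) = fv i \<and>
           (interp B L m z fv gv has_derivative blinfun_apply (gv i)) (at (z i))"
proof
  fix i assume i: "i \<in> {1..m}"
  have lower: "f (z i) + blinfun_apply (gradf (z i)) (y - z i) \<le> interp B L m z fv gv y" for y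
  proof -
    obtain g where "interp B L m z fv gv y = phi B L m z fv gv y g"
      using interp_is_min[OF assms(1,4,6)] by metis
    moreover have "0 \<le> 1 / (2 * L) * (dual_norm B (g - gv i))\<^sup>2"
      using assms(4) by simp
    ultimately show ?thesis
      using phi_ge[OF assms(1) i, of fv gv y z L g] assms(7,8)[OF i] by simp
  qed
  have upper: "interp B L m z fv gv y \<le> f y" for y
  proof -
    have "interp B L m z fv gv y \<le> phi B L m z fv gv y (gradf y)"
      using interp_is_min[OF assms(1,4,6)] by metis
    also have "\<dots> \<le> f y"
      \<comment> \<open>Each piece of the maximum is co-coercivity for the pair \<open>z i\<close>,
        \<open>y\<close>; \<open>m \<ge> 1\<close> makes the index set nonempty.\<close>
      unfolding phi_def
      using cocoercivity[OF assms(1,3,4,5,2)] assms(6,7,8) by (intro Max.boundedI) auto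
    finally show ?thesis .
  qed
  have "interp B L m z fv gv (z i) = fv i"
    using lower[of "z i"] upper[of "z i"] assms(7)[OF i] by simp
  moreover have "(interp B L m z fv gv has_derivative blinfun_apply (gv i)) (at (z i))"
    unfolding assms(8)[OF i] by (rule has_derivative_between_tangent[OF assms(3) lower upper])
  ultimately show "interp B L m z fv gv (z i) = fv i \<and>
      (interp B L m z fv gv has_derivative blinfun_apply (gv i)) (at (z i))" ..
qed

end
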